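(* Let $\mathcal O_n=\{(X_i,Y_i)\}_{i=1}^n$ be an i.i.d. sample of size $n$, let $\hat I_{X,n},\hat I_{Y,n}$ be the estimated directional detectability indices computed from $\mathcal O_n$, and let $D_n=\hat I_{X,n}-\hat I_{Y,n}$, where (by the standing assumptions in the context) $\mathbb P(D_n>0)\to1$. Let $\mathcal O_n^*$ be a nonparametric i.i.d. bootstrap resample drawn from $\mathcal O_n$ and let $D_n^*$ be $D_n$ computed from $\mathcal O_n^*$. Let $B_n\to\infty$ and, for the $b$-th of $B_n$ bootstrap resamples (conditionally i.i.d. given $\mathcal O_n$), let $D_n^{(b)}=\hat I_{X,n}^{(b)}-\hat I_{Y,n}^{(b)}$ be the corresponding value. Define $$\widehat P_{\mathrm{CDSP}}=\frac1{B_n}\sum_{b=1}^{B_n}\mathbf 1\{D_n^{(b)}>0\},\qquad P_{\mathrm{CDSP},n}=\mathbb P(D_n>0).$$ Assume that the bootstrap is asymptotically valid for $D_n$ in the sense that $$\sup_{t\in\mathbb R}\Big|\mathbb P(D_n^*\le t\mid\mathcal O_n)-\mathbb P(D_n\le t)\Big|\xrightarrow{p}0.$$ Then, as $n\to\infty$, $$\widehat P_{\mathrm{CDSP}}-P_{\mathrm{CDSP},n}\xrightarrow{p}0\qquad\text{and}\qquad\widehat P_{\mathrm{CDSP}}\xrightarrow{p}1.$$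
   Context: **Indices.** $\hat I_{X,n}=(\hat\theta_X-\hat c_X^\alpha/n)/\hat\sigma_X$ and $\hat I_{Y,n}=(\hat\theta_Y-\hat c_Y^\alpha/n)/\hat\sigma_Y$, where $\hat\theta_X,\hat\sigma_X,\hat c_X^\alpha$ (resp. with $Y$) are real-valued estimators computed from the sample, estimating constants $\theta_X,\sigma_X,c_X^\alpha$ (resp. with $Y$). They are the estimates of $I_{X,n}=(\theta_X-c_X^\alpha/n)/\sigma_X$ and $I_{Y,n}=(\theta_Y-c_Y^\alpha/n)/\sigma_Y$. **Standing assumptions.** $\sigma_X,\sigma_Y$ are bounded away from zero; $\hat\theta_X\xrightarrow{p}\theta_X$, $\hat\sigma_X\xrightarrow{p}\sigma_X$, $\hat c_X^\alpha\xrightarrow{p}c_X^\alpha$ and likewise with $Y$; and the effect-size asymmetry $\theta_X/\sigma_X>\theta_Y/\sigma_Y$ holds. Under these, $\mathbb P(D_n>0)\to1$. The true causal direction is $X\to Y$, and $D_n>0$ is the event that the procedure favors $X\to Y$. Conditionally on $\mathcal O_n$, each $D_n^{(b)}$ has the law of $D_n^*$. $B_n$ is a deterministic sequence of positive integers. *)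

theory Defs
  imports "HOL-Probability.Probability"
begin

text \<open>
  The variables \<open>V n\<close> are not required to be measurable by the definition, and \<open>measure\<close> of a
  nonmeasurable set is \<open>0\<close>: use it for measurable \<open>V n\<close>.
\<close>

definition tendsto_in_prob :: "'w measure \<Rightarrow> (nat \<Rightarrow> 'w \<Rightarrow> real) \<Rightarrow> real \<Rightarrow> bool" where
  "tendsto_in_prob M V c \<longleftrightarrow>
     (\<forall>\<epsilon>>0. (\<lambda>n. measure M {\<omega>\<in>space M. \<bar>V n \<omega> - c\<bar> > \<epsilon>}) \<longlonglongrightarrow> 0)"

text \<open>
  A sample of size \<open>n\<close> from a measurable space \<open>S\<close> is a point of the product space \<open>sample_space S n\<close>;
  observations are indexed by \<open>0, \<dots>, n - 1\<close>.
\<close>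

definition sample_space :: "'z measure \<Rightarrow> nat \<Rightarrow> (nat \<Rightarrow> 'z) measure" where
  "sample_space S n = PiM {..<n} (\<lambda>_. S)"

definition sample :: "(nat \<Rightarrow> 'w \<Rightarrow> 'x) \<Rightarrow> (nat \<Rightarrow> 'w \<Rightarrow> 'y) \<Rightarrow> nat \<Rightarrow> 'w \<Rightarrow> nat \<Rightarrow> 'x \<times> 'y" where
  "sample X Y n \<omega> = (\<lambda>i\<in>{..<n}. (X i \<omega>, Y i \<omega>))"

definition empirical_measure :: "'z measure \<Rightarrow> nat \<Rightarrow> (nat \<Rightarrow> 'z) \<Rightarrow> 'z measure" where
  "empirical_measure S n z = distr (uniform_count_measure {..<n}) S z"

text \<open>
  The conditional law, given that the observed sample is \<open>z\<close>, of a nonparametric bootstrap resample: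
  \<open>n\<close> independent draws, with replacement, from the \<open>n\<close> points of \<open>z\<close>.
\<close>

definition bootstrap_law :: "'z measure \<Rightarrow> nat \<Rightarrow> (nat \<Rightarrow> 'z) \<Rightarrow> (nat \<Rightarrow> 'z) measure" where
  "bootstrap_law S n z = PiM {..<n} (\<lambda>_. empirical_measure S n z)"

text \<open>
  The random elements \<open>W b\<close>, \<open>b \<in> I\<close>, of \<open>T\<close> are conditionally i.i.d. given the random element
  \<open>V\<close> of \<open>N\<close>, and the common conditional law given \<open>V = v\<close> is \<open>K v\<close>. Taking some of the \<open>A b\<close> to be
  \<open>space T\<close> yields the product formula for subfamilies.
\<close>

definition cond_iid_given ::
  "'w measure \<Rightarrow> 'v measure \<Rightarrow> ('w \<Rightarrow> 'v) \<Rightarrow> 't measure \<Rightarrow> ('v \<Rightarrow> 't measure)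
    \<Rightarrow> 'i set \<Rightarrow> ('i \<Rightarrow> 'w \<Rightarrow> 't) \<Rightarrow> bool" where
  "cond_iid_given M N V T K I W \<longleftrightarrow>
     (\<forall>b\<in>I. W b \<in> M \<rightarrow>\<^sub>M T) \<and>
     (\<forall>A. (\<forall>b\<in>I. A b \<in> sets T) \<longrightarrow>
        (AE \<omega> in M.
           real_cond_exp M (vimage_algebra (space M) V N)
             (indicator {\<omega>\<in>space M. \<forall>b\<in>I. W b \<omega> \<in> A b}) \<omega>
           = (\<Prod>b\<in>I. measure (K (V \<omega>)) (A b))))"

definition index_est ::
  "(nat \<Rightarrow> 's \<Rightarrow> real) \<Rightarrow> (nat \<Rightarrow> 's \<Rightarrow> real) \<Rightarrow> (nat \<Rightarrow> 's \<Rightarrow> real) \<Rightarrow> nat \<Rightarrow> 's \<Rightarrow> real" where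
  "index_est \<theta> \<sigma> c n z = (\<theta> n z - c n z / real n) / \<sigma> n z"

end

theory Submission
  imports Defs
begin

text \<open>
  Conditionally on the sample, each resample has \<open>D \<le> 0\<close> with probability \<open>q n\<close>, which the
  bootstrap assumption at \<open>t = 0\<close> bounds by \<open>P (D \<le> 0)\<close> plus the sup-distance; so \<open>q n\<close> tends to
  \<open>0\<close> in probability and, being bounded, in expectation. But \<open>q n\<close> and \<open>1 - P_hat n\<close> have the same
  expectation, so Markov's inequality concludes. Since the limit is degenerate, no law of large
  numbers over the resamples is needed.

  As \<open>measure\<close> is \<open>0\<close> off the measurable sets, the bootstrap assumption is informative only because
  the sup-distance is a measurable function of the sample: the supremum may be taken over rational
  \<open>t\<close>, and the bootstrap law depends measurably on the sample.
\<close>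

section \<open>Convergence in probability to a constant\<close>

lemma tendsto_in_probD:
  assumes "tendsto_in_prob M V c" "\<epsilon> > 0"
  shows "(\<lambda>n. measure M {\<omega>\<in>space M. \<bar>V n \<omega> - c\<bar> > \<epsilon>}) \<longlonglongrightarrow> 0"
  using assms by (simp add: tendsto_in_prob_def)

text \<open>Domination of the deviations makes one tail event contain the other. Measurability of
  \<open>W n\<close> gives the larger event its true probability; otherwise its measure would
  default to 0 and bound nothing.\<close>

lemma tendsto_in_prob_mono:
  assumes "prob_space M"
    and W: "\<And>n. W n \<in> borel_measurable M"
    and le: "\<And>n \<omega>. \<omega> \<in> space M \<Longrightarrow> \<bar>V n \<omega> - c\<bar> \<le> \<bar>W n \<omega> - d\<bar>"
    and lim: "tendsto_in_prob M W d"
  shows "tendsto_in_prob M V c"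
  unfolding tendsto_in_prob_def
proof (intro allI impI)
  fix \<epsilon> :: real assume "\<epsilon> > 0"
  interpret prob_space M by fact
  have "measure M {\<omega>\<in>space M. \<bar>V n \<omega> - c\<bar> > \<epsilon>} \<le> measure M {\<omega>\<in>space M. \<bar>W n \<omega> - d\<bar> > \<epsilon>}" for n
  proof (rule finite_measure_mono)
    show "{\<omega>\<in>space M. \<bar>W n \<omega> - d\<bar> > \<epsilon>} \<in> sets M"
      using W[of n] by measurable
  qed (use le[of _ n] in force)
  then show "(\<lambda>n. measure M {\<omega>\<in>space M. \<bar>V n \<omega> - c\<bar> > \<epsilon>}) \<longlonglongrightarrow> 0"
    by (intro tendsto_sandwich[OF _ _ tendsto_const
          tendsto_in_probD[OF lim \<open>\<epsilon> > 0\<close>]]) auto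
qed

lemma tendsto_in_prob_of_tendsto:
  assumes "c \<longlonglongrightarrow> l"
  shows "tendsto_in_prob M (\<lambda>n \<omega>. c n) l"
  unfolding tendsto_in_prob_def
proof (intro allI impI)
  fix \<epsilon> :: real assume "\<epsilon> > 0"
  with assms have "\<forall>\<^sub>F n in sequentially. \<bar>c n - l\<bar> < \<epsilon>"
    by (auto simp: tendsto_iff dist_real_def)
  then have "\<forall>\<^sub>F n in sequentially. measure M {\<omega>\<in>space M. \<bar>c n - l\<bar> > \<epsilon>} = 0"
    by eventually_elim simp
  then show "(\<lambda>n. measure M {\<omega>\<in>space M. \<bar>c n - l\<bar> > \<epsilon>}) \<longlonglongrightarrow> 0"
    by (rule tendsto_eventually)
qed

text \<open>Since the limits are constants, the two marginal convergences already control the pair,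
  whatever its joint law. Asking for continuity at the limit point alone lets division be treated
  like the other operations, given a nonzero limit of the denominator.\<close>

lemma tendsto_in_prob_isCont2:
  fixes g :: "real \<times> real \<Rightarrow> real"
  assumes "prob_space M"
    and meas: "\<And>n. U n \<in> borel_measurable M" "\<And>n. V n \<in> borel_measurable M"
    and U: "tendsto_in_prob M U u" and V: "tendsto_in_prob M V v"
    and cont: "isCont g (u, v)"
  shows "tendsto_in_prob M (\<lambda>n \<omega>. g (U n \<omega>, V n \<omega>)) (g (u, v))"
  unfolding tendsto_in_prob_def
proof (intro allI impI)
  fix \<epsilon> :: real assume "\<epsilon> > 0"
  interpret prob_space M by fact
  obtain d where "d > 0" and d: "\<And>p. dist p (u, v) < d \<Longrightarrow> \<bar>g p - g (u, v)\<bar> < \<epsilon>"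
    using cont \<open>\<epsilon> > 0\<close> unfolding continuous_at dist_real_def[symmetric]
    by (metis continuous_at_eps_delta cont)
  \<comment> \<open>Off \<open>?A n\<close> and \<open>?B n\<close> each coordinate deviates by at
    most \<open>d / 3\<close>, so the pair is within \<open>2 * d / 3\<close>, strictly less than
    \<open>d\<close>.\<close>
  let ?A = "\<lambda>n. {\<omega>\<in>space M. \<bar>U n \<omega> - u\<bar> > d / 3}"
  let ?B = "\<lambda>n. {\<omega>\<in>space M. \<bar>V n \<omega> - v\<bar> > d / 3}"
  have sets: "?A n \<in> sets M" "?B n \<in> sets M" for n
    using meas[of n] by measurable
  have sub: "{\<omega>\<in>space M. \<bar>g (U n \<omega>, V n \<omega>) - g (u, v)\<bar> > \<epsilon>} \<subseteq> ?A n \<union> ?B n" for n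
  proof
    fix \<omega> assume \<omega>: "\<omega> \<in> {\<omega>\<in>space M. \<bar>g (U n \<omega>, V n \<omega>) - g (u, v)\<bar> > \<epsilon>}"
    have "dist (U n \<omega>, V n \<omega>) (u, v) \<le> \<bar>U n \<omega> - u\<bar> + \<bar>V n \<omega> - v\<bar>"
      by (simp add: dist_Pair_Pair dist_real_def sqrt_sum_squares_le_sum_abs)
    moreover have "\<not> dist (U n \<omega>, V n \<omega>) (u, v) < d"
      using d[of "(U n \<omega>, V n \<omega>)"] \<omega> by auto
    ultimately show "\<omega> \<in> ?A n \<union> ?B n"
      using \<omega> \<open>d > 0\<close> by auto
  qed
  have "measure M {\<omega>\<in>space M. \<bar>g (U n \<omega>, V n \<omega>) - g (u, v)\<bar> > \<epsilon>}
      \<le> measure M (?A n) + measure M (?B n)" for n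
    using sets by (intro order_trans[OF finite_measure_mono[OF sub] measure_Un_le]) auto
  then have "\<forall>\<^sub>F n in sequentially. norm (measure M {\<omega>\<in>space M. \<bar>g (U n \<omega>, V n \<omega>) - g (u, v)\<bar> > \<epsilon>})
      \<le> measure M (?A n) + measure M (?B n)"
    by simp
  moreover have "(\<lambda>n. measure M (?A n) + measure M (?B n)) \<longlonglongrightarrow> 0"
    using \<open>d > 0\<close> by (intro tendsto_add_zero tendsto_in_probD U V) auto
  ultimately show "(\<lambda>n. measure M {\<omega>\<in>space M. \<bar>g (U n \<omega>, V n \<omega>) - g (u, v)\<bar> > \<epsilon>}) \<longlonglongrightarrow> 0"
    by (rule Lim_null_comparison)
qed

lemma tendsto_in_prob_add:
  assumes "prob_space M" "\<And>n. U n \<in> borel_measurable M" "\<And>n. V n \<in> borel_measurable M"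
    and "tendsto_in_prob M U u" "tendsto_in_prob M V v"
  shows "tendsto_in_prob M (\<lambda>n \<omega>. U n \<omega> + V n \<omega>) (u + v)"
proof -
  have "isCont (\<lambda>p::real \<times> real. fst p + snd p) (u, v)"
    by (intro continuous_intros)
  from tendsto_in_prob_isCont2[OF assms this] show ?thesis
    by simp
qed

lemma tendsto_in_prob_diff:
  assumes "prob_space M" "\<And>n. U n \<in> borel_measurable M" "\<And>n. V n \<in> borel_measurable M"
    and "tendsto_in_prob M U u" "tendsto_in_prob M V v"
  shows "tendsto_in_prob M (\<lambda>n \<omega>. U n \<omega> - V n \<omega>) (u - v)"
proof -
  have "isCont (\<lambda>p::real \<times> real. fst p - snd p) (u, v)"
    by (intro continuous_intros)
  from tendsto_in_prob_isCont2[OF assms this] show ?thesis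
    by simp
qed

lemma tendsto_in_prob_mult:
  assumes "prob_space M" "\<And>n. U n \<in> borel_measurable M" "\<And>n. V n \<in> borel_measurable M"
    and "tendsto_in_prob M U u" "tendsto_in_prob M V v"
  shows "tendsto_in_prob M (\<lambda>n \<omega>. U n \<omega> * V n \<omega>) (u * v)"
proof -
  have "isCont (\<lambda>p::real \<times> real. fst p * snd p) (u, v)"
    by (intro continuous_intros)
  from tendsto_in_prob_isCont2[OF assms this] show ?thesis
    by simp
qed

lemma tendsto_in_prob_divide:
  assumes "prob_space M" "\<And>n. U n \<in> borel_measurable M" "\<And>n. V n \<in> borel_measurable M"
    and "tendsto_in_prob M U u" "tendsto_in_prob M V v" "v \<noteq> 0"
  shows "tendsto_in_prob M (\<lambda>n \<omega>. U n \<omega> / V n \<omega>) (u / v)"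
proof -
  have "isCont (\<lambda>p::real \<times> real. fst p / snd p) (u, v)"
    using \<open>v \<noteq> 0\<close> by (intro continuous_intros) auto
  from tendsto_in_prob_isCont2[OF assms(1-5) this] show ?thesis
    by simp
qed

text \<open>Markov's inequality: a nonnegative variable with a small mean is rarely large.\<close>

lemma tendsto_in_prob_of_expectation:
  fixes V :: "nat \<Rightarrow> 'w \<Rightarrow> real"
  assumes "prob_space M"
    and int: "\<And>n. integrable M (V n)"
    and nonneg: "\<And>n \<omega>. \<omega> \<in> space M \<Longrightarrow> 0 \<le> V n \<omega>"
    and lim: "(\<lambda>n. \<integral>\<omega>. V n \<omega> \<partial>M) \<longlonglongrightarrow> 0"
  shows "tendsto_in_prob M V 0"
  unfolding tendsto_in_prob_def
proof (intro allI impI)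
  fix \<epsilon> :: real assume "\<epsilon> > 0"
  interpret prob_space M by fact
  have "measure M {\<omega>\<in>space M. \<bar>V n \<omega> - 0\<bar> > \<epsilon>} \<le> (\<integral>\<omega>. V n \<omega> \<partial>M) / \<epsilon>" for n
  proof -
    have [measurable]: "V n \<in> borel_measurable M"
      using int by auto
    have "measure M {\<omega>\<in>space M. \<bar>V n \<omega> - 0\<bar> > \<epsilon>} \<le> measure M {\<omega>\<in>space M. V n \<omega> \<ge> \<epsilon>}"
      by (intro finite_measure_mono) (use nonneg[of _ n] in force, measurable)
    also have "\<dots> \<le> (\<integral>\<omega>. V n \<omega> \<partial>M) / \<epsilon>"
      by (rule integral_Markov_inequality_measure[OF int sets.top])
        (use nonneg \<open>\<epsilon> > 0\<close> in auto)
    finally show ?thesis .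
  qed
  then have "\<forall>\<^sub>F n in sequentially. norm (measure M {\<omega>\<in>space M. \<bar>V n \<omega> - 0\<bar> > \<epsilon>})
      \<le> (\<integral>\<omega>. V n \<omega> \<partial>M) / \<epsilon>"
    by simp
  moreover have "(\<lambda>n. (\<integral>\<omega>. V n \<omega> \<partial>M) / \<epsilon>) \<longlonglongrightarrow> 0"
    using tendsto_divide[OF lim tendsto_const, of \<epsilon>] \<open>\<epsilon> > 0\<close> by simp
  ultimately show "(\<lambda>n. measure M {\<omega>\<in>space M. \<bar>V n \<omega> - 0\<bar> > \<epsilon>}) \<longlonglongrightarrow> 0"
    by (rule Lim_null_comparison)
qed

text \<open>Split at the level \<open>e / 2\<close>: off the event \<open>?A n\<close> the variable
  is at most \<open>e / 2\<close>, and on it the bound 1 contributes no more than the probability of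
  the event.\<close>

lemma expectation_tendsto_of_tendsto_in_prob:
  fixes V :: "nat \<Rightarrow> 'w \<Rightarrow> real"
  assumes "prob_space M"
    and V[measurable]: "\<And>n. V n \<in> borel_measurable M"
    and bounds: "\<And>n \<omega>. \<omega> \<in> space M \<Longrightarrow> 0 \<le> V n \<omega> \<and> V n \<omega> \<le> 1"
    and lim: "tendsto_in_prob M V 0"
  shows "(\<lambda>n. \<integral>\<omega>. V n \<omega> \<partial>M) \<longlonglongrightarrow> 0"
proof (rule tendstoI)
  interpret prob_space M by fact
  fix e :: real assume "e > 0"
  let ?A = "\<lambda>n. {\<omega>\<in>space M. \<bar>V n \<omega> - 0\<bar> > e / 2}"
  have int: "integrable M (V n)" for n
    by (rule integrable_const_bound[where B = 1]) (use bounds in auto)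
  have le: "(\<integral>\<omega>. V n \<omega> \<partial>M) \<le> e / 2 + measure M (?A n)" for n
  proof -
    have "(\<integral>\<omega>. V n \<omega> \<partial>M) \<le> (\<integral>\<omega>. e / 2 + indicator (?A n) \<omega> \<partial>M)"
    proof (rule integral_mono[OF int])
      fix \<omega> assume "\<omega> \<in> space M"
      then show "V n \<omega> \<le> e / 2 + indicator (?A n) \<omega>"
        using bounds[of \<omega> n] \<open>e > 0\<close> by (auto simp: indicator_def)
    qed (auto simp: less_top[symmetric])
    also have "\<dots> = e / 2 + measure M (?A n)"
      by (subst Bochner_Integration.integral_add) (auto simp: prob_space less_top[symmetric] Int_absorb2)
    finally show ?thesis .
  qed
  have "(\<lambda>n. measure M (?A n)) \<longlonglongrightarrow> 0"
    using \<open>e > 0\<close> by (intro tendsto_in_probD lim) auto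
  then have "\<forall>\<^sub>F n in sequentially. measure M (?A n) < e / 2"
    using \<open>e > 0\<close> by (intro order_tendstoD(2)) auto
  then show "\<forall>\<^sub>F n in sequentially. dist (\<integral>\<omega>. V n \<omega> \<partial>M) 0 < e"
  proof eventually_elim
    case (elim n)
    moreover have "0 \<le> (\<integral>\<omega>. V n \<omega> \<partial>M)"
      by (rule integral_nonneg_AE) (use bounds in auto)
    ultimately show ?case
      using le[of n] by (simp add: dist_real_def)
  qed
qed

section \<open>Measurability of suprema over the real line\<close>

text \<open>A value above \<open>y\<close> at \<open>t\<close> persists on an interval to the right
  of \<open>t\<close>, hence occurs at a rational. The event that the supremum exceeds
  \<open>y\<close> is therefore a countable union of measurable sets.\<close>

lemma borel_measurable_SUP_right_continuous:
  fixes h :: "'a \<Rightarrow> real \<Rightarrow> real"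
  assumes meas: "\<And>t. (\<lambda>x. h x t) \<in> borel_measurable M"
    and bdd: "\<And>x. x \<in> space M \<Longrightarrow> bdd_above (range (h x))"
    and cont: "\<And>x t. x \<in> space M \<Longrightarrow> continuous (at_right t) (h x)"
  shows "(\<lambda>x. SUP t. h x t) \<in> borel_measurable M"
proof (rule borel_measurableI_greater)
  fix y
  have "y < (SUP t. h x t) \<longleftrightarrow> (\<exists>q\<in>\<rat>. y < h x q)" if x: "x \<in> space M" for x
  proof
    assume "y < (SUP t. h x t)"
    then obtain t where "y < h x t"
      using less_cSUP_iff[OF _ bdd[OF x]] by auto
    moreover have "(h x \<longlongrightarrow> h x t) (at_right t)"
      using cont[OF x] by (simp add: continuous_within)
    ultimately have "\<forall>\<^sub>F s in at_right t. y < h x s"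
      by (rule order_tendstoD(1)[rotated])
    then obtain b where "b > t" "\<And>s. t < s \<Longrightarrow> s < b \<Longrightarrow> y < h x s"
      by (auto simp: eventually_at_right[OF less_add_one])
    then show "\<exists>q\<in>\<rat>. y < h x q"
      using Rats_dense_in_real[of t b] by auto
  next
    assume "\<exists>q\<in>\<rat>. y < h x q"
    then show "y < (SUP t. h x t)"
      using less_cSUP_iff[OF _ bdd[OF x]] by auto
  qed
  then have "{x \<in> space M. y < (SUP t. h x t)} = {x \<in> space M. \<exists>q\<in>\<rat>. y < h x q}"
    by auto
  also have "\<dots> \<in> sets M"
    using meas countable_rat by measurable
  finally show "{x \<in> space M. y < (SUP t. h x t)} \<in> sets M" .
qed

text \<open>The function is the cdf of the law of \<open>f\<close>.\<close>

lemma continuous_at_right_measure_le: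
  fixes f :: "'a \<Rightarrow> real"
  assumes "prob_space N" and f: "f \<in> borel_measurable N"
  shows "continuous (at_right t) (\<lambda>t. measure N {x\<in>space N. f x \<le> t})"
proof -
  interpret N: prob_space N by fact
  interpret distr: real_distribution "distr N borel f"
    using f by (intro N.real_distribution_distr) auto
  have "cdf (distr N borel f) = (\<lambda>t. measure N {x\<in>space N. f x \<le> t})"
    using f by (auto simp: cdf_def fun_eq_iff measure_distr intro!: arg_cong[where f = "measure N"])
  then show ?thesis
    using distr.cdf_is_right_cont by metis
qed

section \<open>The bootstrap law and its dependence on the sample\<close>

lemma sample_space_point:
  assumes "z \<in> space (sample_space S n)" "i < n"
  shows "z i \<in> space S"
  using assms by (auto simp: sample_space_def space_PiM)

lemma sets_bootstrap_law: "sets (bootstrap_law S n z) = sets (sample_space S n)"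
  unfolding bootstrap_law_def sample_space_def
  by (intro sets_PiM_cong) (auto simp: empirical_measure_def)

lemma space_bootstrap_law: "space (bootstrap_law S n z) = space (sample_space S n)"
  by (rule sets_eq_imp_space_eq[OF sets_bootstrap_law])

lemma measurable_resampled_point:
  assumes "z \<in> space (sample_space S n)"
  shows "z \<in> uniform_count_measure {..<n} \<rightarrow>\<^sub>M S"
  using sample_space_point[OF assms]
  by (auto simp: measurable_def space_uniform_count_measure sets_uniform_count_measure)

text \<open>The index \<open>i\<close> witnesses that \<open>n\<close> is positive: for
  \<open>n = 0\<close> the empirical measure has total mass 0. The bootstrap law is a probability
  measure even then, as an empty product.\<close>

lemma prob_space_empirical_measure:
  assumes "z \<in> space (sample_space S n)" "i < n"
  shows "prob_space (empirical_measure S n z)"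
  unfolding empirical_measure_def
  using assms by (intro prob_space.prob_space_distr prob_space_uniform_count_measure
      measurable_resampled_point) auto

lemma prob_space_bootstrap_law:
  assumes "z \<in> space (sample_space S n)"
  shows "prob_space (bootstrap_law S n z)"
  unfolding bootstrap_law_def
  using assms by (intro prob_space_PiM prob_space_empirical_measure) auto

text \<open>Resampling is drawing the indices uniformly: this realises all the laws
  \<open>bootstrap_law S n z\<close> on one probability space, not depending on \<open>z\<close>.\<close>

lemma bootstrap_law_eq_distr:
  assumes z: "z \<in> space (sample_space S n)"
  shows "bootstrap_law S n z
    = distr (PiM {..<n} (\<lambda>_. uniform_count_measure {..<n})) (sample_space S n) (compose {..<n} z)"
proof -
  let ?U = "uniform_count_measure {..<n}" and ?E = "empirical_measure S n z"
  \<comment> \<open>The target of \<open>distr\<close> matters only through its measurable sets, so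
    \<open>?E\<close> may stand in for \<open>S\<close>; this brings the factors into the form of
    the rule for images of product measures.\<close>
  have E: "distr ?U ?E z = ?E"
    unfolding empirical_measure_def by (intro distr_cong) auto
  have "PiM {..<n} (\<lambda>_. distr ?U ?E z)
      = distr (PiM {..<n} (\<lambda>_. ?U)) (PiM {..<n} (\<lambda>_. ?E)) (compose {..<n} z)"
  proof (rule distr_PiM_finite_prob_space'[symmetric])
    show "z \<in> ?U \<rightarrow>\<^sub>M ?E"
      using measurable_resampled_point[OF z] unfolding empirical_measure_def by simp
  qed (auto intro: prob_space_uniform_count_measure prob_space_empirical_measure[OF z])
  also have "\<dots> = distr (PiM {..<n} (\<lambda>_. ?U)) (sample_space S n) (compose {..<n} z)"
    using sets_bootstrap_law[of S n z] by (intro distr_cong) (auto simp: bootstrap_law_def)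
  finally show ?thesis
    by (simp add: bootstrap_law_def E)
qed

text \<open>Each resampled point is the sample evaluated at a random index. The index takes finitely
  many values, and for each fixed value the evaluation is a coordinate projection.\<close>

lemma measurable_resample:
  "(\<lambda>(z, f). compose {..<n} z f)
    \<in> sample_space S n \<Otimes>\<^sub>M PiM {..<n} (\<lambda>_. uniform_count_measure {..<n}) \<rightarrow>\<^sub>M sample_space S n"
  (is "_ \<in> ?P \<rightarrow>\<^sub>M _")
proof -
  have "(\<lambda>p. fst p (snd p i)) \<in> ?P \<rightarrow>\<^sub>M S" if "i < n" for i
  proof (rule measurable_compose_countable'[where I = "{..<n}" and f = "\<lambda>j p. fst p j"])
    show "(\<lambda>p. fst p j) \<in> ?P \<rightarrow>\<^sub>M S" if "j \<in> {..<n}" for j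
      unfolding sample_space_def using that by simp
    have "(\<lambda>p. snd p i) \<in> ?P \<rightarrow>\<^sub>M uniform_count_measure {..<n}"
      by measurable (use \<open>i < n\<close> in simp)
    then show "(\<lambda>p. snd p i) \<in> ?P \<rightarrow>\<^sub>M count_space {..<n}"
      by (rule measurable_cong_sets[OF refl, THEN equalityD1, THEN subsetD, rotated])
        (simp add: sets_uniform_count_measure)
  qed auto
  then have "(\<lambda>p. \<lambda>i\<in>{..<n}. fst p (snd p i)) \<in> ?P \<rightarrow>\<^sub>M PiM {..<n} (\<lambda>_. S)"
    by (intro measurable_restrict) auto
  then show ?thesis
    by (simp add: sample_space_def compose_def case_prod_beta')
qed

text \<open>With the indices drawn from a law \<open>?Q\<close> that is the same for all samples,
  the mass of \<open>A\<close> is the \<open>?Q\<close>-measure of the section at \<open>z\<close>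
  of one jointly measurable set \<open>?R\<close>, and the measure of a section depends measurably
  on the base point.\<close>

lemma borel_measurable_measure_bootstrap_law:
  assumes A: "A \<in> sets (sample_space S n)"
  shows "(\<lambda>z. measure (bootstrap_law S n z) A) \<in> borel_measurable (sample_space S n)"
proof -
  let ?Q = "PiM {..<n} (\<lambda>_. uniform_count_measure {..<n})"
  let ?r = "\<lambda>(z, f). compose {..<n} z f"
  interpret Q: prob_space ?Q
    by (intro prob_space_PiM prob_space_uniform_count_measure) auto
  let ?R = "?r -` A \<inter> space (sample_space S n \<Otimes>\<^sub>M ?Q)"
  have R: "?R \<in> sets (sample_space S n \<Otimes>\<^sub>M ?Q)"
    by (rule measurable_sets[OF measurable_resample A])
  have "measure (bootstrap_law S n z) A = enn2real (emeasure ?Q (Pair z -` ?R))"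
    if z: "z \<in> space (sample_space S n)" for z
  proof -
    have "compose {..<n} z \<in> ?Q \<rightarrow>\<^sub>M sample_space S n"
      using measurable_compose[OF measurable_Pair1'[OF z] measurable_resample] by simp
    then have "measure (bootstrap_law S n z) A = measure ?Q (compose {..<n} z -` A \<inter> space ?Q)"
      unfolding bootstrap_law_eq_distr[OF z] using A by (rule measure_distr)
    also have "compose {..<n} z -` A \<inter> space ?Q = Pair z -` ?R"
      using z by (auto simp: space_pair_measure)
    finally show ?thesis
      by (simp add: measure_def)
  qed
  moreover have "(\<lambda>z. enn2real (emeasure ?Q (Pair z -` ?R))) \<in> borel_measurable (sample_space S n)"
    using Q.measurable_emeasure_Pair[OF R] by measurable
  ultimately show ?thesis
    by (simp cong: measurable_cong)
qed

section \<open>From conditional to unconditional probabilities\<close>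

text \<open>The tower property, applied to the product formula with every set but the
  \<open>b\<close>-th equal to \<open>space T\<close>; the other factors are 1 because each
  \<open>K v\<close> is a probability measure.\<close>

lemma cond_iid_given_prob:
  assumes "prob_space M"
    and iid: "cond_iid_given M N V T K I W"
    and V: "V \<in> M \<rightarrow>\<^sub>M N"
    and I: "finite I" "b \<in> I"
    and A: "A \<in> sets T"
    and K: "\<And>v. v \<in> space N \<Longrightarrow> prob_space (K v)" "\<And>v. v \<in> space N \<Longrightarrow> space (K v) = space T"
    and meas: "(\<lambda>v. measure (K v) A) \<in> borel_measurable N"
  shows "measure M {\<omega>\<in>space M. W b \<omega> \<in> A} = (\<integral>\<omega>. measure (K (V \<omega>)) A \<partial>M)"
proof -
  interpret prob_space M by fact
  let ?F = "vimage_algebra (space M) V N"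
  interpret F: finite_measure_subalgebra M ?F
  proof
    show "subalgebra M ?F"
      unfolding subalgebra_def
      using sets_image_in_sets[OF refl V] by simp
  qed
  have W: "W b \<in> M \<rightarrow>\<^sub>M T" if "b \<in> I" for b
    using iid that by (simp add: cond_iid_given_def)
  define C where "C = (\<lambda>i. if i = b then A else space T)"
  let ?E = "{\<omega>\<in>space M. W b \<omega> \<in> A}"
  have E: "?E \<in> sets M"
    using measurable_sets[OF W A] I by (simp add: vimage_def Int_def conj_commute)
  have "{\<omega>\<in>space M. \<forall>i\<in>I. W i \<omega> \<in> C i} = ?E"
    using I measurable_space[OF W] by (auto simp: C_def)
  moreover have "C i \<in> sets T" for i
    using A by (simp add: C_def)
  ultimately have "AE \<omega> in M. real_cond_exp M ?F (indicator ?E) \<omega>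
      = (\<Prod>i\<in>I. measure (K (V \<omega>)) (C i))"
    using iid[unfolded cond_iid_given_def, THEN conjunct2, THEN spec, of C] by simp
  moreover have "(\<Prod>i\<in>I. measure (K (V \<omega>)) (C i)) = measure (K (V \<omega>)) A"
    if "\<omega> \<in> space M" for \<omega>
  proof -
    have v: "V \<omega> \<in> space N"
      using V that by (rule measurable_space)
    have "measure (K (V \<omega>)) (space T) = 1"
      using prob_space.prob_space[OF K(1)[OF v]] K(2)[OF v] by simp
    then have "(\<Prod>i\<in>I. measure (K (V \<omega>)) (C i))
        = (\<Prod>i\<in>I. if i = b then measure (K (V \<omega>)) A else 1)"
      by (intro prod.cong) (auto simp: C_def)
    then show ?thesis
      using I by simp
  qed
  ultimately have AE: "AE \<omega> in M. real_cond_exp M ?F (indicator ?E) \<omega> = measure (K (V \<omega>)) A"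
    by (auto cong: AE_cong)
  have "measure M ?E = (\<integral>\<omega>. indicator ?E \<omega> \<partial>M)"
    using E by simp
  also have "\<dots> = (\<integral>\<omega>. real_cond_exp M ?F (indicator ?E) \<omega> \<partial>M)"
    using E by (intro F.real_cond_exp_int(2)[symmetric]) (auto simp: less_top[symmetric])
  also have "\<dots> = (\<integral>\<omega>. measure (K (V \<omega>)) A \<partial>M)"
    using measurable_compose[OF V meas] AE by (intro integral_cong_AE) auto
  finally show ?thesis .
qed

section \<open>The limit of an estimated index\<close>

text \<open>The correction is a convergent factor times the null sequence \<open>1 / real n\<close>,
  so only the effect size survives in the limit.\<close>

lemma tendsto_in_prob_index_est:
  assumes "prob_space M"
    and Z: "\<And>n. Z n \<in> M \<rightarrow>\<^sub>M sample_space S n"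
    and meas: "\<And>n. \<theta>h n \<in> borel_measurable (sample_space S n)"
      "\<And>n. \<sigma>h n \<in> borel_measurable (sample_space S n)"
      "\<And>n. ch n \<in> borel_measurable (sample_space S n)"
    and cons: "tendsto_in_prob M (\<lambda>n \<omega>. \<theta>h n (Z n \<omega>)) \<theta>"
      "tendsto_in_prob M (\<lambda>n \<omega>. \<sigma>h n (Z n \<omega>)) \<sigma>"
      "tendsto_in_prob M (\<lambda>n \<omega>. ch n (Z n \<omega>)) c"
    and "\<sigma> \<noteq> 0"
  shows "tendsto_in_prob M (\<lambda>n \<omega>. index_est \<theta>h \<sigma>h ch n (Z n \<omega>)) (\<theta> / \<sigma>)"
proof -
  have [measurable]: "(\<lambda>\<omega>. \<theta>h n (Z n \<omega>)) \<in> borel_measurable M"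
    "(\<lambda>\<omega>. \<sigma>h n (Z n \<omega>)) \<in> borel_measurable M" "(\<lambda>\<omega>. ch n (Z n \<omega>)) \<in> borel_measurable M" for n
    using measurable_compose[OF Z meas(1)] measurable_compose[OF Z meas(2)]
      measurable_compose[OF Z meas(3)] by auto
  have "tendsto_in_prob M (\<lambda>n \<omega>. ch n (Z n \<omega>) * (1 / real n)) (c * 0)"
    by (intro tendsto_in_prob_mult[OF assms(1)] cons
        tendsto_in_prob_of_tendsto lim_1_over_n) measurable
  then have "tendsto_in_prob M
      (\<lambda>n \<omega>. (\<theta>h n (Z n \<omega>) - ch n (Z n \<omega>) * (1 / real n)) / \<sigma>h n (Z n \<omega>)) ((\<theta> - c * 0) / \<sigma>)"
    by (intro tendsto_in_prob_divide[OF assms(1)] tendsto_in_prob_diff[OF assms(1)] cons \<open>\<sigma> \<noteq> 0\<close>)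
      measurable
  then show ?thesis
    by (simp add: index_est_def)
qed

theorem proposition1:
  fixes M :: "'w measure" and SX :: "'x measure" and SY :: "'y measure"
    and X :: "nat \<Rightarrow> 'w \<Rightarrow> 'x" and Y :: "nat \<Rightarrow> 'w \<Rightarrow> 'y"
    and \<theta>hX \<sigma>hX chX \<theta>hY \<sigma>hY chY D :: "nat \<Rightarrow> (nat \<Rightarrow> 'x \<times> 'y) \<Rightarrow> real"
    and \<theta>X \<sigma>X cX \<theta>Y \<sigma>Y cY :: real
    and B :: "nat \<Rightarrow> nat"
    and Oboot :: "nat \<Rightarrow> nat \<Rightarrow> 'w \<Rightarrow> nat \<Rightarrow> 'x \<times> 'y"
    and P_hat :: "nat \<Rightarrow> 'w \<Rightarrow> real" and P_CDSP :: "nat \<Rightarrow> real"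
  assumes prob: "prob_space M"
    \<comment> \<open>the observations are i.i.d.\<close>
    and indep: "prob_space.indep_vars M (\<lambda>_. SX \<Otimes>\<^sub>M SY) (\<lambda>i \<omega>. (X i \<omega>, Y i \<omega>)) UNIV"
    and ident: "\<And>i. distr M (SX \<Otimes>\<^sub>M SY) (\<lambda>\<omega>. (X i \<omega>, Y i \<omega>))
                    = distr M (SX \<Otimes>\<^sub>M SY) (\<lambda>\<omega>. (X 0 \<omega>, Y 0 \<omega>))"
    \<comment> \<open>the estimators are statistics of the sample\<close>
    and meas_X: "\<And>n. \<theta>hX n \<in> borel_measurable (sample_space (SX \<Otimes>\<^sub>M SY) n)"
                "\<And>n. \<sigma>hX n \<in> borel_measurable (sample_space (SX \<Otimes>\<^sub>M SY) n)"
                "\<And>n. chX n \<in> borel_measurable (sample_space (SX \<Otimes>\<^sub>M SY) n)"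
    and meas_Y: "\<And>n. \<theta>hY n \<in> borel_measurable (sample_space (SX \<Otimes>\<^sub>M SY) n)"
                "\<And>n. \<sigma>hY n \<in> borel_measurable (sample_space (SX \<Otimes>\<^sub>M SY) n)"
                "\<And>n. chY n \<in> borel_measurable (sample_space (SX \<Otimes>\<^sub>M SY) n)"
    \<comment> \<open>standing assumptions: scales bounded away from zero, consistency, effect-size asymmetry\<close>
    and scales: "\<exists>\<epsilon>>0. \<bar>\<sigma>X\<bar> \<ge> \<epsilon> \<and> \<bar>\<sigma>Y\<bar> \<ge> \<epsilon>"
    and cons_X: "tendsto_in_prob M (\<lambda>n \<omega>. \<theta>hX n (sample X Y n \<omega>)) \<theta>X"
                "tendsto_in_prob M (\<lambda>n \<omega>. \<sigma>hX n (sample X Y n \<omega>)) \<sigma>X"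
                "tendsto_in_prob M (\<lambda>n \<omega>. chX n (sample X Y n \<omega>)) cX"
    and cons_Y: "tendsto_in_prob M (\<lambda>n \<omega>. \<theta>hY n (sample X Y n \<omega>)) \<theta>Y"
                "tendsto_in_prob M (\<lambda>n \<omega>. \<sigma>hY n (sample X Y n \<omega>)) \<sigma>Y"
                "tendsto_in_prob M (\<lambda>n \<omega>. chY n (sample X Y n \<omega>)) cY"
    and asym: "\<theta>X / \<sigma>X > \<theta>Y / \<sigma>Y"
    and D: "\<And>n z. D n z = index_est \<theta>hX \<sigma>hX chX n z - index_est \<theta>hY \<sigma>hY chY n z"
    \<comment> \<open>number of resamples, and the resamples themselves\<close>
    and B_pos: "\<And>n. B n > 0"
    and B_lim: "filterlim B at_top sequentially"
    and resamples: "\<And>n. cond_iid_given M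
            (sample_space (SX \<Otimes>\<^sub>M SY) n) (sample X Y n)
            (sample_space (SX \<Otimes>\<^sub>M SY) n) (bootstrap_law (SX \<Otimes>\<^sub>M SY) n)
            {..<B n} (Oboot n)"
    \<comment> \<open>asymptotic validity of the bootstrap for \<open>D\<close>\<close>
    and boot_valid: "tendsto_in_prob M
          (\<lambda>n \<omega>. SUP t::real.
             \<bar>measure (bootstrap_law (SX \<Otimes>\<^sub>M SY) n (sample X Y n \<omega>))
                 {z \<in> space (sample_space (SX \<Otimes>\<^sub>M SY) n). D n z \<le> t}
              - measure M {\<omega>'\<in>space M. D n (sample X Y n \<omega>') \<le> t}\<bar>) 0"
    and P_hat: "\<And>n \<omega>. P_hat n \<omega>
          = (1 / real (B n)) * (\<Sum>b<B n. of_bool (D n (Oboot n b \<omega>) > 0))"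
    and P_CDSP: "\<And>n. P_CDSP n = measure M {\<omega>\<in>space M. D n (sample X Y n \<omega>) > 0}"
  shows "tendsto_in_prob M (\<lambda>n \<omega>. P_hat n \<omega> - P_CDSP n) 0
       \<and> tendsto_in_prob M P_hat 1"
proof -
  interpret prob_space M by fact
  let ?S = "SX \<Otimes>\<^sub>M SY"
  let ?T = "sample_space ?S" and ?Z = "sample X Y" and ?K = "bootstrap_law ?S"

  \<comment> \<open>Measurability of the statistics and of the sup-distance\<close>
  have Z[measurable]: "?Z n \<in> M \<rightarrow>\<^sub>M ?T n" for n
    using indep unfolding indep_vars_def sample_def sample_space_def
    by (intro measurable_restrict) auto
  have D_meas[measurable]: "D n \<in> borel_measurable (?T n)" for n
    using meas_X[of n] meas_Y[of n] unfolding D index_est_def by measurable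
  have DX: "(\<lambda>\<omega>. index_est \<theta>hX \<sigma>hX chX n (?Z n \<omega>)) \<in> borel_measurable M" for n
    using meas_X[of n] unfolding index_est_def by measurable
  have DY: "(\<lambda>\<omega>. index_est \<theta>hY \<sigma>hY chY n (?Z n \<omega>)) \<in> borel_measurable M" for n
    using meas_Y[of n] unfolding index_est_def by measurable
  have DZ[measurable]: "(\<lambda>\<omega>. D n (?Z n \<omega>)) \<in> borel_measurable M" for n
    by measurable
  define G where "G n t = {z \<in> space (?T n). D n z \<le> t}" for n t
  have G[measurable]: "G n t \<in> sets (?T n)" for n t
    unfolding G_def by measurable
  define F where "F n t = measure M {\<omega>\<in>space M. D n (?Z n \<omega>) \<le> t}" for n t
  define H where "H n \<omega> t = \<bar>measure (?K n (?Z n \<omega>)) (G n t) - F n t\<bar>" for n \<omega> t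
  \<comment> \<open>The bootstrap cdf at 0: the conditional probability that a resample fails to
    favor \<open>X\<close> as the cause. Ties \<open>D = 0\<close> count as failures, matching the
    strict inequality in \<open>P_hat\<close>.\<close>
  define q where "q n \<omega> = measure (?K n (?Z n \<omega>)) (G n 0)" for n \<omega>
  have K_meas[measurable]: "(\<lambda>\<omega>. measure (?K n (?Z n \<omega>)) (G n t)) \<in> borel_measurable M" for n t
    by (rule measurable_compose[OF Z borel_measurable_measure_bootstrap_law[OF G]])
  have K_prob: "prob_space (?K n (?Z n \<omega>))" if "\<omega> \<in> space M" for n \<omega>
    using measurable_space[OF Z that] by (rule prob_space_bootstrap_law)
  \<comment> \<open>A real \<open>SUP\<close> is a least upper bound only when the set is bounded
    above; 2 is a crude bound for the gap between two probabilities.\<close>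
  have H_bdd: "bdd_above (range (H n \<omega>))" if "\<omega> \<in> space M" for n \<omega>
  proof (rule bdd_aboveI2)
    interpret K: prob_space "?K n (?Z n \<omega>)"
      by (rule K_prob[OF that])
    show "H n \<omega> t \<le> 2" for t
      using K.prob_le_1[of "G n t"] prob_le_1[of "{\<omega>\<in>space M. D n (?Z n \<omega>) \<le> t}"]
        measure_nonneg[of "?K n (?Z n \<omega>)" "G n t"]
        measure_nonneg[of M "{\<omega>\<in>space M. D n (?Z n \<omega>) \<le> t}"]
      unfolding H_def F_def by linarith
  qed
  \<comment> \<open>\<open>H n \<omega>\<close> is the absolute difference of two cdfs, of
    \<open>D n\<close> under the bootstrap law and of \<open>D n\<close> at the observed
    sample.\<close>
  have H_cont: "continuous (at_right t) (H n \<omega>)" if "\<omega> \<in> space M" for n \<omega> t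
  proof -
    have "continuous (at_right t) (\<lambda>t. measure (?K n (?Z n \<omega>)) (G n t))"
      using continuous_at_right_measure_le[OF K_prob[OF that], of "D n" n t] D_meas[of n]
      by (simp add: G_def space_bootstrap_law sets_bootstrap_law cong: measurable_cong_sets)
    then show ?thesis
      unfolding H_def F_def
      by (intro continuous_intros continuous_at_right_measure_le[OF prob DZ])
  qed
  have SUP_meas: "(\<lambda>\<omega>. SUP t. H n \<omega> t) \<in> borel_measurable M" for n
  proof (rule borel_measurable_SUP_right_continuous[OF _ H_bdd H_cont])
    show "(\<lambda>\<omega>. H n \<omega> t) \<in> borel_measurable M" for t
      unfolding H_def by measurable
  qed

  \<comment> \<open>The probability of a nonpositive \<open>D\<close> vanishes\<close>
  define \<Delta> where "\<Delta> = \<theta>X / \<sigma>X - \<theta>Y / \<sigma>Y"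
  have \<Delta>: "\<Delta> > 0"
    using asym by (simp add: \<Delta>_def)
  have "tendsto_in_prob M (\<lambda>n \<omega>. D n (?Z n \<omega>)) \<Delta>"
    unfolding D \<Delta>_def using scales
    by (intro tendsto_in_prob_diff[OF prob] DX DY
        tendsto_in_prob_index_est[OF prob Z meas_X cons_X]
        tendsto_in_prob_index_est[OF prob Z meas_Y cons_Y]) auto
  \<comment> \<open>A nonpositive \<open>D\<close> deviates from \<open>\<Delta>\<close> by at least
    \<open>\<Delta>\<close>; halving the threshold makes this deviation strict.\<close>
  then have far: "(\<lambda>n. measure M {\<omega>\<in>space M. \<bar>D n (?Z n \<omega>) - \<Delta>\<bar> > \<Delta> / 2}) \<longlonglongrightarrow> 0"
    by (rule tendsto_in_probD) (use \<Delta> in auto)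
  have "F n 0 \<le> measure M {\<omega>\<in>space M. \<bar>D n (?Z n \<omega>) - \<Delta>\<bar> > \<Delta> / 2}" for n
    unfolding F_def
  proof (rule finite_measure_mono)
    show "{\<omega>\<in>space M. D n (?Z n \<omega>) \<le> 0}
        \<subseteq> {\<omega>\<in>space M. \<bar>D n (?Z n \<omega>) - \<Delta>\<bar> > \<Delta> / 2}"
    proof clarify
      fix \<omega> assume "D n (?Z n \<omega>) \<le> 0"
      then show "\<bar>D n (?Z n \<omega>) - \<Delta>\<bar> > \<Delta> / 2"
        using \<Delta> by linarith
    qed
  qed measurable
  then have F0: "(\<lambda>n. F n 0) \<longlonglongrightarrow> 0"
    by (intro Lim_null_comparison[OF always_eventually far]) (simp add: F_def)

  \<comment> \<open>The conditional failure probability \<open>q\<close> vanishes\<close>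
  have "tendsto_in_prob M (\<lambda>n \<omega>. (SUP t. H n \<omega> t) + F n 0) (0 + 0)"
    using boot_valid SUP_meas
    by (intro tendsto_in_prob_add[OF prob] tendsto_in_prob_of_tendsto[OF F0])
      (auto simp: H_def F_def G_def)
  then have "tendsto_in_prob M q 0"
  proof (rule tendsto_in_prob_mono[OF prob, rotated 2])
    fix n \<omega> assume \<omega>: "\<omega> \<in> space M"
    have "H n \<omega> 0 \<le> (SUP t. H n \<omega> t)"
      by (rule cSUP_upper[OF _ H_bdd[OF \<omega>]]) simp
    then have "q n \<omega> \<le> (SUP t. H n \<omega> t) + F n 0"
      unfolding H_def q_def by linarith
    then show "\<bar>q n \<omega> - 0\<bar> \<le> \<bar>(SUP t. H n \<omega> t) + F n 0 - (0 + 0)\<bar>"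
      unfolding q_def by (simp add: abs_of_nonneg)
  qed (use SUP_meas in measurable)
  then have q_lim: "(\<lambda>n. \<integral>\<omega>. q n \<omega> \<partial>M) \<longlonglongrightarrow> 0"
    using K_prob unfolding q_def
    by (intro expectation_tendsto_of_tendsto_in_prob[OF prob])
      (auto intro: prob_space.prob_le_1)

  \<comment> \<open>The share of failing resamples\<close>
  let ?N = "\<lambda>n b. {\<omega>\<in>space M. Oboot n b \<omega> \<in> G n 0}"
  have O_meas: "Oboot n b \<in> M \<rightarrow>\<^sub>M ?T n" if "b < B n" for n b
    using resamples[of n] that by (simp add: cond_iid_given_def)
  have N: "?N n b \<in> sets M" if "b < B n" for n b
    using measurable_sets[OF O_meas[OF that] G] by (simp add: vimage_def Int_def conj_commute)
  \<comment> \<open>The failure probability is the same for every \<open>b\<close>, so the mean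
    share of failures is again the mean of \<open>q n\<close>. The resamples are dependent through
    the common sample, but linearity of the integral is indifferent to that.\<close>
  have prob_N: "measure M (?N n b) = (\<integral>\<omega>. q n \<omega> \<partial>M)" if "b < B n" for n b
    unfolding q_def
    using that
    by (intro cond_iid_given_prob[OF prob resamples Z _ _ G] prob_space_bootstrap_law
        space_bootstrap_law borel_measurable_measure_bootstrap_law[OF G]) auto
  \<comment> \<open>Positivity of \<open>B n\<close> matters: as division by 0 yields 0, without
    resamples the left side would be 1 and the right side 0.\<close>
  have P_hat_eq: "1 - P_hat n \<omega> = (\<Sum>b<B n. indicator (?N n b) \<omega>) / real (B n)"
    if "\<omega> \<in> space M" for n \<omega>
  proof -
    have "indicator (?N n b) \<omega> = 1 - (of_bool (D n (Oboot n b \<omega>) > 0) :: real)" if "b < B n" for b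
      using measurable_space[OF O_meas[OF that] \<open>\<omega> \<in> space M\<close>] \<open>\<omega> \<in> space M\<close>
      by (auto simp: G_def indicator_def)
    then have "(\<Sum>b<B n. indicator (?N n b) \<omega>)
        = real (B n) - (\<Sum>b<B n. of_bool (D n (Oboot n b \<omega>) > 0))"
      by (simp add: sum_subtractf)
    then show ?thesis
      using B_pos[of n] by (simp add: P_hat field_simps)
  qed
  have N_int: "integrable M (indicator (?N n b) :: _ \<Rightarrow> real)" if "b < B n" for n b
    using N[OF that] by (simp add: less_top[symmetric])
  have E_eq: "(\<integral>\<omega>. (\<Sum>b<B n. indicator (?N n b) \<omega>) / real (B n) \<partial>M) = (\<integral>\<omega>. q n \<omega> \<partial>M)" for n
    using B_pos[of n] N prob_N N_int by (simp add: Int_absorb2)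
  let ?V = "\<lambda>n \<omega>. (\<Sum>b<B n. indicator (?N n b) \<omega>) / real (B n)"
  have V_int: "integrable M (?V n)" for n
    by (intro integrable_divide_zero Bochner_Integration.integrable_sum N_int) simp
  have "tendsto_in_prob M ?V 0"
  proof (rule tendsto_in_prob_of_expectation[OF prob V_int])
    show "(\<lambda>n. \<integral>\<omega>. ?V n \<omega> \<partial>M) \<longlonglongrightarrow> 0"
      unfolding E_eq by (rule q_lim)
  qed (simp add: sum_nonneg)
  then have P_hat_lim: "tendsto_in_prob M P_hat 1"
  proof (rule tendsto_in_prob_mono[OF prob _ _, rotated 2])
    show "\<bar>P_hat n \<omega> - 1\<bar> \<le> \<bar>?V n \<omega> - 0\<bar>" if "\<omega> \<in> space M" for n \<omega>
      using P_hat_eq[OF that, of n] by linarith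
  qed (use V_int in auto)

  \<comment> \<open>Comparison with \<open>P_CDSP\<close>\<close>
  have "P_CDSP n = 1 - F n 0" for n
  proof -
    have "{\<omega>\<in>space M. D n (?Z n \<omega>) > 0} = space M - {\<omega>\<in>space M. D n (?Z n \<omega>) \<le> 0}"
      by auto
    then show ?thesis
      unfolding P_CDSP F_def by (simp add: prob_compl)
  qed
  then have "P_CDSP = (\<lambda>n. 1 - F n 0)"
    by auto
  then have P_lim: "P_CDSP \<longlonglongrightarrow> 1"
    using tendsto_diff[OF tendsto_const F0, of 1] by simp
  \<comment> \<open>Measurability is read off from \<open>?V n\<close>, a combination of indicators
    of measurable events, with which \<open>1 - P_hat n\<close> agrees on
    \<open>space M\<close>.\<close>
  have "P_hat n \<in> borel_measurable M" for n
  proof -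
    have "(\<lambda>\<omega>. 1 - ?V n \<omega>) \<in> borel_measurable M"
      using V_int by auto
    then show ?thesis
      by (rule measurable_cong[THEN iffD1, rotated]) (simp flip: P_hat_eq)
  qed
  then have "tendsto_in_prob M (\<lambda>n \<omega>. P_hat n \<omega> - P_CDSP n) (1 - 1)"
    by (intro tendsto_in_prob_diff[OF prob] P_hat_lim tendsto_in_prob_of_tendsto[OF P_lim]) auto
  with P_hat_lim show ?thesis
    by simp
qed

end
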